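(* There is an absolute constant $C$ such that for all $n$ and $W$, $$\mathrm{vfg}(n,W)\le C\cdot\max\{\mathrm{vufg}(n',W') : n'\le Cn^2,\ W'\le CW\}.$$
   Context: For a directed graph $G=(V,E)$ with nonnegative vertex weights $w$, $\mathrm{vdist}_w(s,t)$ is the minimum over $s\leadsto t$ paths $\pi$ of the total weight of the interior vertices of $\pi$. A set $X\subseteq V$ is an integral vertex cut for the pairs at vertex-weighted distance $\ge1$ if for every $(s,t)$ with $\mathrm{vdist}_w(s,t)\ge1$, every $s\leadsto t$ path contains an internal node (other than $s,t$) in $X$. $\mathrm{vfg}(n,W)$ is the least integer such that for every $n$-node directed graph with nonnegative vertex costs $\mathrm{cost}$ and nonnegative vertex weights $w$ with $w(V)=W$, there is such a cut $X$ with $\mathrm{cost}(X)\le\langle\mathrm{cost},w\rangle\cdot\mathrm{vfg}(n,W)$, where $\mathrm{cost}(X)=\sum_{v\in X}\mathrm{cost}(v)$ and $\langle\mathrm{cost},w\rangle=\sum_v\mathrm{cost}(v)w(v)$. $\mathrm{vufg}(n,W)$ is defined the same way but only over instances in which every vertex has cost $1$. *)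

theory Defs
  imports Complex_Main "Graph_Theory.Graph_Theory" "Graph_Theory.Kuratowski"
begin

context pre_digraph
begin

text \<open>
  The infimum ranges over a finite set whenever the digraph is finite, so it is a minimum if
  \<open>t\<close> is reachable from \<open>s\<close>; otherwise it is \<open>\<infinity>\<close>. For \<open>s = t\<close> the only simple path is the
  empty one, so the distance is \<open>0\<close>.
\<close>

definition vdist :: "('a \<Rightarrow> real) \<Rightarrow> 'a \<Rightarrow> 'a \<Rightarrow> ereal" where
  "vdist w s t = (INF p \<in> {p. apath s p t}. ereal (\<Sum>v \<leftarrow> inner_verts p. w v))"

text \<open>A simple path does not revisit its endpoints, so its inner vertices differ from
  \<open>s\<close> and \<open>t\<close>.\<close>

definition integral_vertex_cut :: "('a \<Rightarrow> real) \<Rightarrow> 'a set \<Rightarrow> bool" where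
  "integral_vertex_cut w X \<longleftrightarrow>
     X \<subseteq> verts G \<and>
     (\<forall>s \<in> verts G. \<forall>t \<in> verts G. vdist w s t \<ge> 1 \<longrightarrow>
        (\<forall>p. apath s p t \<longrightarrow> set (inner_verts p) \<inter> X \<noteq> {}))"

end

text \<open>Taking natural numbers as vertices loses no generality, since every finite digraph is
  isomorphic to one of this form.\<close>

definition vfg_instance ::
  "nat \<Rightarrow> real \<Rightarrow> nat pair_pre_digraph \<Rightarrow> (nat \<Rightarrow> real) \<Rightarrow> (nat \<Rightarrow> real) \<Rightarrow> bool" where
  "vfg_instance n W G cost w \<longleftrightarrow>
     pair_fin_digraph G \<and> card (pverts G) = n \<and>
     (\<forall>v \<in> pverts G. 0 \<le> cost v) \<and> (\<forall>v \<in> pverts G. 0 \<le> w v) \<and>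
     (\<Sum>v \<in> pverts G. w v) = W"

definition has_cut_within_gap ::
  "nat pair_pre_digraph \<Rightarrow> (nat \<Rightarrow> real) \<Rightarrow> (nat \<Rightarrow> real) \<Rightarrow> nat \<Rightarrow> bool" where
  "has_cut_within_gap G cost w k \<longleftrightarrow>
     (\<exists>X. pre_digraph.integral_vertex_cut (with_proj G) w X \<and>
          (\<Sum>v \<in> X. cost v) \<le> (\<Sum>v \<in> pverts G. cost v * w v) * real k)"

text \<open>
  The least integer is taken among the natural numbers. For \<open>n \<ge> 1\<close> and \<open>W > 0\<close> this is no
  restriction (with unit costs a negative gap would require a cut of negative cardinality). If
  \<open>W = 0\<close>, or if there are no instances at all, every integer is admissible and there is no
  least one; the value is then \<open>0\<close>. The set of admissible numbers is never empty: \<open>n\<close> is in it,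
  as the vertices of weight at least \<open>1/n\<close> form a cut.
\<close>

definition vfg :: "nat \<Rightarrow> real \<Rightarrow> nat" where
  "vfg n W = (LEAST k. \<forall>G cost w. vfg_instance n W G cost w \<longrightarrow> has_cut_within_gap G cost w k)"

definition vufg :: "nat \<Rightarrow> real \<Rightarrow> nat" where
  "vufg n W =
     (LEAST k. \<forall>G cost w. vfg_instance n W G cost w \<and> (\<forall>v \<in> pverts G. cost v = 1) \<longrightarrow>
        has_cut_within_gap G cost w k)"

end

(*
  Call a vertex light if its weight is below 1/(2n). All light vertices of a path together weigh at
  most 1/2, so they may be made uncuttable, provided the other weights are doubled. This is done by
  bypassing them: in the unit-cost graph only heavy vertices are interior vertices, and arcs stand
  for paths through light vertices. A heavy vertex v is represented by about cost(v)/S parallel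
  copies, all of which have to be cut in order to separate at v. With S = <cost,w>/w(V) the rounding
  costs only a factor 2 in the total weight, and since heavy vertices have weight at least 1/(2n),
  the number of copies is O(n w(V)). Truncating w at 1 does not affect which pairs are far apart and
  gives w(V) <= n, hence O(n^2) vertices.
*)
theory Submission
  imports Defs "HOL-Library.Nat_Bijection"
begin

section \<open>Walks as lists of interior vertices\<close>

abbreviation walk_via :: "('a \<times> 'a) set \<Rightarrow> 'a \<Rightarrow> 'a list \<Rightarrow> 'a \<Rightarrow> bool" where
  "walk_via E s xs t \<equiv> successively (\<lambda>a b. (a, b) \<in> E) (s # xs @ [t])"

lemma walk_via_append:
  "walk_via E s (xs @ x # ys) t \<longleftrightarrow> walk_via E s xs x \<and> walk_via E x ys t"
  by (induction xs arbitrary: s) (auto simp: successively_Cons)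

text \<open>Once the rest of the walk has been made simple, only a return to \<open>s\<close> can
  spoil it, and everything before that return is dropped. This is needed because projecting a path
  of the blowup may give a walk that repeats vertices.\<close>

lemma walk_via_shortcut:
  assumes "walk_via E s xs t" "s \<noteq> t"
  shows "\<exists>ys. set ys \<subseteq> set xs \<and> walk_via E s ys t \<and> distinct (s # ys @ [t])"
  using assms
proof (induction xs arbitrary: s)
  case Nil
  then show ?case by (intro exI[of _ "[]"]) auto
next
  case (Cons x xs)
  have sx: "(s, x) \<in> E" and xt: "walk_via E x xs t" using Cons.prems by auto
  show ?case
  proof (cases "x = t")
    case True
    then show ?thesis using sx Cons.prems by (intro exI[of _ "[]"]) auto
  next
    case False
    then obtain ys where ys: "set ys \<subseteq> set xs" "walk_via E x ys t" "distinct (x # ys @ [t])"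
      using Cons.IH[OF xt] by blast
    show ?thesis
    proof (cases "s \<in> set (x # ys)")
      case True
      then obtain as bs where ab: "x # ys = as @ s # bs" by (meson split_list)
      have "walk_via E s ([] @ x # ys) t" using sx ys(2) by simp
      then have "walk_via E s (as @ s # bs) t" using ab by simp
      then have "walk_via E s bs t" unfolding walk_via_append by blast
      moreover have "set bs \<subseteq> set (x # ys)" using ab by auto
      moreover have "distinct ((as @ s # bs) @ [t])" using ys(3) ab by (metis append_Cons)
      ultimately show ?thesis using ys(1) by (intro exI[of _ bs]) auto
    next
      case False
      then show ?thesis using ys sx Cons.prems(2) by (intro exI[of _ "x # ys"]) auto
    qed
  qed
qed

section \<open>Simple paths and vertex cuts in terms of vertex lists\<close>

context pair_wf_digraph
begin

lemma apath_imp_walk_via: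
  assumes "apath s p t" "s \<noteq> t"
  shows "walk_via (parcs G) s (inner_verts p) t" "distinct (s # inner_verts p @ [t])"
proof -
  \<comment> \<open>The empty walk has only one vertex, so its vertex list does not have this shape;
    \<open>s \<noteq> t\<close> rules it out below.\<close>
  have *: "walk_via (parcs G) s (inner_verts p) t \<and> pawalk_verts s p = s # inner_verts p @ [t]"
    if "p \<noteq> []" "pcas s p t" "set p \<subseteq> parcs G" for s
    using that
  proof (induction p arbitrary: s)
    case (Cons e p)
    show ?case
    proof (cases "p = []")
      case True
      then show ?thesis using Cons.prems by (cases e) (auto simp: inner_verts_with_proj_def)
    next
      case False
      then have "inner_verts (e # p) = snd e # inner_verts p"
        using Cons.prems by (cases p) (auto simp: inner_verts_with_proj_def)
      then show ?thesis using False Cons.prems Cons.IH[of "snd e"] by (cases e) auto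
    qed
  qed auto
  have "p \<noteq> []" using assms by (auto simp: apath_def awalk_def)
  with assms * show "walk_via (parcs G) s (inner_verts p) t" "distinct (s # inner_verts p @ [t])"
    by (auto simp: apath_def awalk_def)
qed

lemma walk_via_imp_apath:
  assumes "walk_via (parcs G) s xs t" "distinct (s # xs @ [t])"
  shows "\<exists>p. apath s p t \<and> inner_verts p = xs"
proof -
  \<comment> \<open>Arcs of a pair digraph are pairs of vertices, so pairing consecutive vertices
    recovers the walk.\<close>
  define p where "p = zip (s # xs) (xs @ [t])"
  have "pcas s p t \<and> set p \<subseteq> parcs G \<and> pawalk_verts s p = s # xs @ [t] \<and> p \<noteq> []"
    using assms(1) unfolding p_def
    by (induction xs arbitrary: s) auto
  moreover have "inner_verts p = xs" unfolding p_def inner_verts_with_proj_def by (simp add: map_fst_zip_take)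
  moreover have "s \<in> pverts G"
    using assms(1) by (cases xs) (auto dest: in_arcsD1)
  ultimately show ?thesis using assms(2) by (intro exI[of _ p]) (auto simp: apath_def awalk_def)
qed

lemma walk_via_in_verts:
  assumes "walk_via (parcs G) s xs t"
  shows "s \<in> pverts G" "t \<in> pverts G" "set xs \<subseteq> pverts G"
  using assms
  by (induction xs arbitrary: s) (auto dest: in_arcsD1 in_arcsD2)

text \<open>Simple paths between different endpoints correspond to distinct vertex lists, along
  which list sums are set sums. A pair with \<open>s = t\<close> is never far apart because of the
  empty path, and endpoints outside the graph admit no walk.\<close>

lemma integral_vertex_cut_iff:
  "integral_vertex_cut w X \<longleftrightarrow> X \<subseteq> pverts G \<and>
     (\<forall>s t. s \<noteq> t \<longrightarrow>
        (\<forall>xs. walk_via (parcs G) s xs t \<and> distinct (s # xs @ [t]) \<longrightarrow> 1 \<le> sum w (set xs)) \<longrightarrow>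
        (\<forall>xs. walk_via (parcs G) s xs t \<and> distinct (s # xs @ [t]) \<longrightarrow> set xs \<inter> X \<noteq> {}))"
  (is "_ \<longleftrightarrow> _ \<and> (\<forall>s t. _ \<longrightarrow> ?far s t \<longrightarrow> ?cut s t)")
proof -
  have far: "vdist w s t \<ge> 1 \<longleftrightarrow> ?far s t" if "s \<noteq> t" for s t
  proof -
    have "vdist w s t \<ge> 1 \<longleftrightarrow> (\<forall>p. apath s p t \<longrightarrow> 1 \<le> (\<Sum>v \<leftarrow> inner_verts p. w v))"
      by (auto simp: vdist_def le_INF_iff one_ereal_def)
    also have "\<dots> \<longleftrightarrow> ?far s t"
      using apath_imp_walk_via[OF _ that] walk_via_imp_apath[of s _ t]
      by (auto simp: sum_list_distinct_conv_sum_set)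
    finally show ?thesis .
  qed
  have cut: "(\<forall>p. apath s p t \<longrightarrow> set (inner_verts p) \<inter> X \<noteq> {}) \<longleftrightarrow> ?cut s t" if "s \<noteq> t" for s t
    using apath_imp_walk_via[OF _ that] walk_via_imp_apath[of s _ t] by blast
  have same: "\<not> vdist w s s \<ge> 1" if "s \<in> pverts G" for s
  proof -
    have "vdist w s s \<le> ereal (\<Sum>v \<leftarrow> inner_verts []. w v)"
      unfolding vdist_def using that by (intro INF_lower) (auto simp: apath_def awalk_def)
    then show ?thesis by (auto simp: one_ereal_def dest: order_trans)
  qed
  show ?thesis (is "_ \<longleftrightarrow> ?R")
  proof
    assume L: "integral_vertex_cut w X"
    have "?cut s t" if "s \<noteq> t" "?far s t" for s t
    proof (intro allI impI)
      fix xs assume xs: "walk_via (parcs G) s xs t \<and> distinct (s # xs @ [t])"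
      then have "s \<in> pverts G" "t \<in> pverts G" using walk_via_in_verts by blast+
      then have "?cut s t"
        using L that unfolding integral_vertex_cut_def far[OF that(1), symmetric] cut[OF that(1), symmetric]
        by simp
      with xs show "set xs \<inter> X \<noteq> {}" by blast
    qed
    moreover have "X \<subseteq> pverts G" using L by (simp add: integral_vertex_cut_def)
    ultimately show ?R by blast
  next
    assume R: ?R
    have "\<forall>p. apath s p t \<longrightarrow> set (inner_verts p) \<inter> X \<noteq> {}"
      if "s \<in> pverts G" "vdist w s t \<ge> 1" for s t
    proof -
      have st: "s \<noteq> t" using same that by blast
      show ?thesis unfolding cut[OF st] using R st that(2) unfolding far[OF st] by blast
    qed
    then show "integral_vertex_cut w X" using R by (simp add: integral_vertex_cut_def)
  qed
qed

end


section \<open>The blowup: copying vertices and bypassing light ones\<close>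

text \<open>Copies \<open>(v, 0)\<close> have no incoming and copies \<open>(v, 1)\<close> no outgoing arcs. They only serve as
  endpoints of paths, so it is useless to cut them. The proper copies of \<open>v\<close> are \<open>(v, i + 2)\<close> with
  \<open>i < k v\<close>; the intended \<open>k\<close> is \<open>0\<close> on \<open>L\<close>.\<close>

definition blowup :: "nat pair_pre_digraph \<Rightarrow> nat set \<Rightarrow> (nat \<Rightarrow> nat) \<Rightarrow> nat pair_pre_digraph" where
  "blowup G L k =
     \<lparr> pverts = prod_encode ` (SIGMA v:pverts G. {..<k v + 2}),
       parcs = {(prod_encode (u, i), prod_encode (v, j)) | u i v j.
         u \<in> pverts G \<and> i < k u + 2 \<and> i \<noteq> 1 \<and> v \<in> pverts G \<and> j < k v + 2 \<and> j \<noteq> 0 \<and>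
         (\<exists>ls. set ls \<subseteq> L \<and> walk_via (parcs G) u ls v)} \<rparr>"

text \<open>Endpoint copies are never interior, so weight 0 does not affect distances and keeps them
  out of the total weight.\<close>

definition blowup_weight :: "(nat \<Rightarrow> real) \<Rightarrow> nat \<Rightarrow> real" where
  "blowup_weight w x = (case prod_decode x of (v, i) \<Rightarrow> if i < 2 then 0 else w v)"

lemma blowup_weight_encode [simp]:
  "blowup_weight w (prod_encode (v, i)) = (if i < 2 then 0 else w v)"
  by (simp add: blowup_weight_def)

lemma blowup_arc_iff:
  "(prod_encode (u, i), prod_encode (v, j)) \<in> parcs (blowup G L k) \<longleftrightarrow>
     u \<in> pverts G \<and> i < k u + 2 \<and> i \<noteq> 1 \<and> v \<in> pverts G \<and> j < k v + 2 \<and> j \<noteq> 0 \<and>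
     (\<exists>ls. set ls \<subseteq> L \<and> walk_via (parcs G) u ls v)"
  by (auto simp: blowup_def)

lemma blowup_arcE:
  assumes "(x, y) \<in> parcs (blowup G L k)"
  obtains u i v j where "x = prod_encode (u, i)" "y = prod_encode (v, j)" "i \<noteq> 1" "j \<noteq> 0"
    "i < k u + 2" "j < k v + 2"
    "\<exists>ls. set ls \<subseteq> L \<and> walk_via (parcs G) u ls v"
  using assms unfolding blowup_def by simp blast

lemma sum_blowup:
  fixes f :: "nat \<Rightarrow> 'b::comm_monoid_add"
  assumes "finite (pverts G)"
  shows "sum f (pverts (blowup G L k)) = (\<Sum>v\<in>pverts G. \<Sum>i<k v + 2. f (prod_encode (v, i)))"
  using assms
  by (simp add: blowup_def sum.reindex inj_on_def sum.Sigma del: sum.lessThan_Suc add_2_eq_Suc')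

lemma pair_fin_digraph_blowup:
  assumes "finite (pverts G)"
  shows "pair_fin_digraph (blowup G L k)"
proof
  show fin: "finite (pverts (blowup G L k))" using assms by (simp add: blowup_def)
  have sub: "parcs (blowup G L k) \<subseteq> pverts (blowup G L k) \<times> pverts (blowup G L k)"
    by (auto simp: blowup_def)
  then show "finite (parcs (blowup G L k))" using fin by (meson finite_SigmaI finite_subset)
  show "\<And>e. e \<in> parcs (blowup G L k) \<Longrightarrow> fst e \<in> pverts (blowup G L k)"
    "\<And>e. e \<in> parcs (blowup G L k) \<Longrightarrow> snd e \<in> pverts (blowup G L k)"
    using sub by auto
qed

text \<open>Each arc is expanded into a walk through \<open>L\<close> that it stands for, so the new
  vertices all lie in \<open>L\<close>.\<close>

lemma blowup_walk_project:
  assumes "walk_via (parcs (blowup G L k)) x xs y"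
    "\<And>v. prod_decode x \<noteq> (v, 1)"
  shows "(\<forall>z \<in> set xs. 2 \<le> snd (prod_decode z)) \<and>
    (\<exists>ys. walk_via (parcs G) (fst (prod_decode x)) ys (fst (prod_decode y)) \<and>
      set ys \<subseteq> L \<union> (fst \<circ> prod_decode) ` set xs)"
  using assms
proof (induction xs arbitrary: x)
  case Nil
  then have "(x, y) \<in> parcs (blowup G L k)" by simp
  then show ?case by (elim blowup_arcE) auto
next
  case (Cons z xs)
  have xz: "(x, z) \<in> parcs (blowup G L k)" and zy: "walk_via (parcs (blowup G L k)) z xs y"
    using Cons.prems(1) by auto
  obtain u i v j where 1: "x = prod_encode (u, i)" "z = prod_encode (v, j)" "j \<noteq> 0"
    "\<exists>ls. set ls \<subseteq> L \<and> walk_via (parcs G) u ls v"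
    using xz by (elim blowup_arcE) blast
  \<comment> \<open>As an interior vertex, \<open>z\<close> has an arc entering it, which excludes
    index 0, and one leaving it, which excludes index 1.\<close>
  obtain z' where "(z, z') \<in> parcs (blowup G L k)"
    using zy by (cases xs) auto
  then have "j \<noteq> 1" using 1(2) by (elim blowup_arcE) auto
  then have j: "2 \<le> j" using 1(3) by simp
  from 1 obtain ls where ls: "set ls \<subseteq> L" "walk_via (parcs G) u ls v" by blast
  obtain ys where ys: "\<forall>z \<in> set xs. 2 \<le> snd (prod_decode z)"
    "walk_via (parcs G) v ys (fst (prod_decode y))" "set ys \<subseteq> L \<union> (fst \<circ> prod_decode) ` set xs"
    using Cons.IH[OF zy] 1 \<open>j \<noteq> 1\<close> by auto
  have "walk_via (parcs G) u (ls @ v # ys) (fst (prod_decode y))"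
    using ls(2) ys(2) by (simp only: walk_via_append)
  then show ?case using 1 j ys ls by (auto intro!: exI[of _ "ls @ v # ys"])
qed

text \<open>The vertices outside \<open>L\<close> are replaced by copies of free choice
  \<open>f\<close>, and the stretches between them become arcs. In the induction, \<open>ls\<close>
  collects the vertices of \<open>L\<close> passed since the last copy
  \<open>(u, i)\<close>.\<close>

lemma blowup_walk_lift:
  assumes "pair_wf_digraph G"
    "\<And>v. v \<in> set xs - L \<Longrightarrow> f v < k v"
    "set ls \<subseteq> L" "walk_via (parcs G) u (ls @ xs) t" "i < k u + 2" "i \<noteq> 1"
  shows "walk_via (parcs (blowup G L k)) (prod_encode (u, i))
    (map (\<lambda>v. prod_encode (v, f v + 2)) (filter (\<lambda>v. v \<notin> L) xs)) (prod_encode (t, 1))"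
  using assms(2-)
proof (induction xs arbitrary: ls u i)
  case Nil
  then show ?case using pair_wf_digraph.walk_via_in_verts[OF assms(1), of u ls t]
    by (auto simp: blowup_arc_iff)
next
  case (Cons x xs)
  show ?case
  proof (cases "x \<in> L")
    case True
    then show ?thesis using Cons.prems Cons.IH[of "ls @ [x]" u i] by auto
  next
    case False
    have w: "walk_via (parcs G) u ls x" "walk_via (parcs G) x ([] @ xs) t"
      using Cons.prems(3) unfolding walk_via_append by auto
    have "f x < k x" using Cons.prems(1) False by simp
    then have "walk_via (parcs (blowup G L k)) (prod_encode (x, f x + 2))
      (map (\<lambda>v. prod_encode (v, f v + 2)) (filter (\<lambda>v. v \<notin> L) xs)) (prod_encode (t, 1))"
      using Cons.IH[OF _ _ w(2), of "f x + 2"] Cons.prems(1) by auto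
    moreover have "(prod_encode (u, i), prod_encode (x, f x + 2)) \<in> parcs (blowup G L k)"
      using w(1) pair_wf_digraph.walk_via_in_verts[OF assms(1) w(1)] Cons.prems False \<open>f x < k x\<close>
      by (auto simp: blowup_arc_iff)
    ultimately show ?thesis using False by simp
  qed
qed

text \<open>A vertex is cut once all its copies are. Far pairs stay far, as walks of the blowup
  project to \<open>G\<close>; and a path of \<open>G\<close> that misses the cut has an uncut copy
  of each vertex outside \<open>L\<close>, so it lifts to a path that misses \<open>X'\<close>. A
  vertex outside \<open>L\<close> with \<open>k v = 0\<close> is cut automatically.\<close>

lemma integral_vertex_cut_blowup:
  assumes G: "pair_fin_digraph G"
    and w': "\<And>v. v \<in> pverts G \<Longrightarrow> 0 \<le> w' v"
    and far: "\<And>s xs t. walk_via (parcs G) s xs t \<Longrightarrow> distinct xs \<Longrightarrow> 1 \<le> sum w (set xs) \<Longrightarrow>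
      1 \<le> sum w' (set xs - L)"
    and X': "pre_digraph.integral_vertex_cut (with_proj (blowup G L k)) (blowup_weight w') X'"
  shows "pre_digraph.integral_vertex_cut (with_proj G) w
    {v \<in> pverts G - L. \<forall>i<k v. prod_encode (v, i + 2) \<in> X'}" (is "pre_digraph.integral_vertex_cut _ _ ?X")
proof -
  interpret G: pair_fin_digraph G by (rule G)
  interpret B: pair_fin_digraph "blowup G L k"
    by (rule pair_fin_digraph_blowup) (rule G.pair_finite_verts)
  let ?walk = "\<lambda>s xs t. walk_via (parcs G) s xs t \<and> distinct (s # xs @ [t])"
  show ?thesis
    unfolding G.integral_vertex_cut_iff
  proof (intro conjI allI impI)
    fix s t xs
    assume st: "s \<noteq> t" and dist: "\<forall>xs. ?walk s xs t \<longrightarrow> 1 \<le> sum w (set xs)" and xs: "?walk s xs t"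
    have "1 \<le> sum (blowup_weight w') (set zs)"
      if zs: "walk_via (parcs (blowup G L k)) (prod_encode (s, 0)) zs (prod_encode (t, 1))" for zs
    proof -
      obtain ys where ys: "\<forall>z \<in> set zs. 2 \<le> snd (prod_decode z)" "walk_via (parcs G) s ys t"
        "set ys \<subseteq> L \<union> (fst \<circ> prod_decode) ` set zs"
        using blowup_walk_project[OF zs] by auto
      obtain ys' where ys': "set ys' \<subseteq> set ys" "?walk s ys' t"
        using walk_via_shortcut[OF ys(2) st] by blast
      have "1 \<le> sum w' (set ys' - L)"
        using far[of s ys' t] ys'(2) dist by auto
      also have "\<dots> \<le> sum (blowup_weight w') (set zs)"
      \<comment> \<open>Every vertex of \<open>ys'\<close> outside \<open>L\<close> has a proper
        copy of the same weight in \<open>zs\<close>, and different vertices have different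
        copies.\<close>
      proof (rule sum_le_included[where i = "fst \<circ> prod_decode"])
        have "set zs \<subseteq> pverts (blowup G L k)" using B.walk_via_in_verts[OF zs] by blast
        then show "\<forall>z \<in> set zs. 0 \<le> blowup_weight w' z"
          using w' by (auto simp: blowup_def)
        show "\<forall>v \<in> set ys' - L. \<exists>z \<in> set zs. (fst \<circ> prod_decode) z = v \<and> w' v \<le> blowup_weight w' z"
        proof
          fix v assume v: "v \<in> set ys' - L"
          then have "v \<in> (fst \<circ> prod_decode) ` set zs" using ys(3) ys'(1) by blast
          then obtain z where z: "z \<in> set zs" "v = (fst \<circ> prod_decode) z" by blast
          moreover have "w' v = blowup_weight w' z"
            using z ys(1) by (auto simp: blowup_weight_def split: prod.split)
          ultimately show "\<exists>z \<in> set zs. (fst \<circ> prod_decode) z = v \<and> w' v \<le> blowup_weight w' z"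
            by auto
        qed
      qed auto
      finally show ?thesis .
    qed
    moreover have "prod_encode (s, 0) \<noteq> prod_encode (t, 1)" by simp
    ultimately have cut: "set zs \<inter> X' \<noteq> {}"
      if "walk_via (parcs (blowup G L k)) (prod_encode (s, 0)) zs (prod_encode (t, 1))"
        "distinct (prod_encode (s, 0) # zs @ [prod_encode (t, 1)])" for zs
      using X'[unfolded B.integral_vertex_cut_iff, THEN conjunct2, rule_format,
          of "prod_encode (s, 0)" "prod_encode (t, 1)" zs] that by presburger
    show "set xs \<inter> ?X \<noteq> {}"
    proof
      assume "set xs \<inter> ?X = {}"
      then have "\<forall>v \<in> set xs - L. \<exists>i<k v. prod_encode (v, i + 2) \<notin> X'"
        using G.walk_via_in_verts[of s xs t] xs by blast
      then obtain f where f: "\<And>v. v \<in> set xs - L \<Longrightarrow> f v < k v \<and> prod_encode (v, f v + 2) \<notin> X'"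
        by metis
      let ?zs = "map (\<lambda>v. prod_encode (v, f v + 2)) (filter (\<lambda>v. v \<notin> L) xs)"
      have "walk_via (parcs (blowup G L k)) (prod_encode (s, 0)) ?zs (prod_encode (t, 1))"
        using xs f by (intro blowup_walk_lift[where ls = "[]"] G.pair_wf_digraph_axioms) auto
      \<comment> \<open>The chosen copies differ in their first coordinate, and their indices, at
        least 2, separate them from the endpoints.\<close>
      moreover have "distinct (prod_encode (s, 0) # ?zs @ [prod_encode (t, 1)])"
        using xs by (auto simp: distinct_map inj_on_def)
      ultimately have "set ?zs \<inter> X' \<noteq> {}" by (rule cut)
      then show False using f by auto
    qed
  qed auto
qed

section \<open>Light and heavy vertices on a path\<close>

lemma light_sum_le:
  fixes w :: "'a \<Rightarrow> real"
  assumes "finite V" "A \<subseteq> V" "\<And>v. v \<in> A \<Longrightarrow> w v \<le> c / real (card V)" "0 \<le> c"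
  shows "sum w A \<le> c"
proof -
  have "sum w A \<le> of_nat (card A) * (c / real (card V))"
    by (rule sum_bounded_above) (use assms in auto)
  also have "\<dots> \<le> real (card V) * (c / real (card V))"
    using assms by (intro mult_right_mono) (auto intro: card_mono)
  \<comment> \<open>If \<open>V\<close> is empty, the quotient is 0 by convention and
    \<open>0 \<le> c\<close> suffices.\<close>
  also have "\<dots> \<le> c" using assms(4) by auto
  finally show ?thesis .
qed

text \<open>Truncation at 1 is harmless: either a single vertex already reaches 1 or nothing gets
  truncated. Light vertices account for at most half, and doubling makes up for it.\<close>

lemma heavy_sum_ge:
  fixes w :: "nat \<Rightarrow> real"
  assumes V: "finite V" "A \<subseteq> V" and nonneg: "\<And>v. v \<in> V \<Longrightarrow> 0 \<le> w v" and "1 \<le> sum w A"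
  shows "1 \<le> (\<Sum>v \<in> A - {v \<in> V. w v < 1 / (2 * real (card V))}. 2 * min (w v) 1)"
    (is "1 \<le> sum _ (A - ?L)")
proof -
  have fin: "finite A" using V finite_subset by blast
  have one: "1 \<le> (\<Sum>v\<in>A. min (w v) 1)"
  proof (cases "\<exists>v\<in>A. 1 \<le> w v")
    case True
    then obtain v where v: "v \<in> A" "1 \<le> w v" by blast
    have "min (w v) 1 \<le> (\<Sum>v\<in>A. min (w v) 1)"
      by (rule member_le_sum) (use v fin V nonneg in auto)
    then show ?thesis using v by simp
  next
    case False
    then have "(\<Sum>v\<in>A. min (w v) 1) = sum w A" by (intro sum.cong) auto
    then show ?thesis using assms by simp
  qed
  have "(\<Sum>v\<in>A \<inter> ?L. min (w v) 1) \<le> 1/2"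
    by (rule light_sum_le[OF V(1)]) (use V in auto)
  moreover have "(\<Sum>v\<in>A. min (w v) 1) = (\<Sum>v\<in>A \<inter> ?L. min (w v) 1) + (\<Sum>v\<in>A - ?L. min (w v) 1)"
    using fin by (rule sum.Int_Diff)
  ultimately show ?thesis using one by (simp add: sum_distrib_left[symmetric])
qed

section \<open>The trivial bound on the gap\<close>

text \<open>A path avoiding all vertices of weight at least \<open>1/n\<close> weighs less than 1,
  and cutting such a vertex costs at most \<open>n\<close> times its share of the scalar product.
  This makes the least gaps exist and be attained.\<close>

lemma has_cut_within_gap_card:
  assumes "vfg_instance n W G cost w"
  shows "has_cut_within_gap G cost w n"
proof -
  interpret G: pair_fin_digraph G using assms by (simp add: vfg_instance_def)
  have n: "card (pverts G) = n" and cost: "\<And>v. v \<in> pverts G \<Longrightarrow> 0 \<le> cost v"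
    and w: "\<And>v. v \<in> pverts G \<Longrightarrow> 0 \<le> w v"
    using assms by (auto simp: vfg_instance_def)
  define X where "X = {v \<in> pverts G. 1 / real n \<le> w v}"
  have "G.integral_vertex_cut w X"
    unfolding G.integral_vertex_cut_iff
  proof (intro conjI allI impI)
    show "X \<subseteq> pverts G" by (auto simp: X_def)
    fix s t xs
    assume far: "\<forall>xs. walk_via (parcs G) s xs t \<and> distinct (s # xs @ [t]) \<longrightarrow> 1 \<le> sum w (set xs)"
      and xs: "walk_via (parcs G) s xs t \<and> distinct (s # xs @ [t])"
    have ge: "1 \<le> sum w (set xs)" using far xs by blast
    have sub: "set xs \<subseteq> pverts G" using xs G.walk_via_in_verts by blast
    show "set xs \<inter> X \<noteq> {}"
    proof
      assume "set xs \<inter> X = {}"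
      then have lt: "w v < 1 / real n" if "v \<in> set xs" for v
        using that sub by (force simp: X_def)
      have ne: "set xs \<noteq> {}" using ge by auto
      have "sum w (set xs) < (\<Sum>v\<in>set xs. 1 / real n)"
        by (rule sum_strict_mono) (use ne lt in auto)
      also have "\<dots> \<le> 1"
        by (rule light_sum_le[OF G.pair_finite_verts sub]) (use n in auto)
      finally show False using ge by simp
    qed
  qed
  moreover have "sum cost X \<le> (\<Sum>v\<in>pverts G. cost v * w v) * real n"
  proof (cases "n = 0")
    case True
    then show ?thesis using n G.pair_finite_verts by (auto simp: X_def)
  next
    case False
    have "sum cost X \<le> (\<Sum>v\<in>X. cost v * w v * real n)"
    proof (rule sum_mono)
      fix v assume v: "v \<in> X"
      then have "1 \<le> w v * real n" using False by (auto simp: X_def field_simps)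
      then show "cost v \<le> cost v * w v * real n"
        using cost[of v] v mult_left_mono[of 1 "w v * real n" "cost v"] by (auto simp: X_def mult.assoc)
    qed
    also have "\<dots> \<le> (\<Sum>v\<in>pverts G. cost v * w v * real n)"
      using cost w G.pair_finite_verts by (intro sum_mono2) (auto simp: X_def)
    finally show ?thesis by (simp add: sum_distrib_right)
  qed
  ultimately show ?thesis unfolding has_cut_within_gap_def by blast
qed

lemma vufg_le: "vufg n W \<le> n"
  unfolding vufg_def by (rule Least_le) (use has_cut_within_gap_card in blast)

lemma vufg_cut:
  assumes "vfg_instance n W G (\<lambda>_. 1) w"
  shows "has_cut_within_gap G (\<lambda>_. 1) w (vufg n W)"
proof -
  have "\<forall>G cost w. vfg_instance n W G cost w \<and> (\<forall>v \<in> pverts G. cost v = 1) \<longrightarrow>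
        has_cut_within_gap G cost w (vufg n W)"
    unfolding vufg_def by (rule LeastI[where k = n]) (use has_cut_within_gap_card in blast)
  then show ?thesis using assms by simp
qed

section \<open>Reduction to unit costs\<close>

text \<open>The factor 4 comes from doubling the weights and from rounding up the numbers of copies,
  each of which at most doubles the total weight.\<close>

lemma cut_from_unit_costs:
  assumes inst: "vfg_instance n W G cost w"
    and M: "\<And>n' W'. real n' \<le> 6 * (real n)\<^sup>2 \<Longrightarrow> 0 \<le> W' \<Longrightarrow> W' \<le> 6 * W \<Longrightarrow> vufg n' W' \<le> M"
  shows "has_cut_within_gap G cost w (4 * M)"
proof -
  interpret G: pair_fin_digraph G using inst by (simp add: vfg_instance_def)
  let ?V = "pverts G"
  have finV: "finite ?V" by (rule G.pair_finite_verts)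
  have n: "card ?V = n" and cost: "\<And>v. v \<in> ?V \<Longrightarrow> 0 \<le> cost v"
    and w: "\<And>v. v \<in> ?V \<Longrightarrow> 0 \<le> w v" and W: "sum w ?V = W"
    using inst by (auto simp: vfg_instance_def)
  define L where "L = {v \<in> ?V. w v < 1 / (2 * real n)}"
  define m where "m v = min (w v) 1" for v
  \<comment> \<open>The cost of one copy: the average cost under the truncated weight
    \<open>m\<close>, so that the copies before rounding have total \<open>m\<close>-weight
    \<open>sum m ?V\<close> if \<open>S > 0\<close>.\<close>
  define S where "S = (\<Sum>v\<in>?V. cost v * m v) / sum m ?V"
  \<comment> \<open>If all heavy vertices cost nothing, then \<open>S = 0\<close> and \<open>k = 0\<close>, so all of them are cut for free.\<close>
  define k where "k v = (if v \<in> L then 0 else nat \<lceil>cost v / S\<rceil>)" for v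
  define B where "B = blowup G L k"
  define w' where "w' = blowup_weight (\<lambda>v. 2 * m v)"
  have m: "0 \<le> m v" "m v \<le> w v" "m v \<le> 1" if "v \<in> ?V" for v
    using w[OF that] by (auto simp: m_def)
  \<comment> \<open>Truncation keeps the lower bound \<open>1/(2n)\<close>, which is at most 1
    because the graph has a vertex.\<close>
  have heavy: "1 \<le> 2 * real n * m v" if "v \<in> ?V - L" for v
  proof -
    have "card ?V \<noteq> 0" using that finV by auto
    then have "n \<noteq> 0" "1 \<le> real n" using n by auto
    then show ?thesis using that by (auto simp: L_def m_def min_def field_simps)
  qed
  have S0: "0 \<le> S" unfolding S_def using cost m by (intro divide_nonneg_nonneg sum_nonneg) auto
  have msum: "0 \<le> sum m ?V" "sum m ?V \<le> W" "sum m ?V \<le> n"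
    using m W n sum_bounded_above[of ?V m 1] by (auto intro: sum_nonneg sum_mono)
  have mS: "(\<Sum>v\<in>?V. cost v * m v) = S * sum m ?V"
  proof (cases "sum m ?V = 0")
    case True
    then have "\<forall>v\<in>?V. m v = 0" using finV m(1) by (simp add: sum_nonneg_eq_0_iff)
    then show ?thesis by simp
  qed (simp add: S_def)
  \<comment> \<open>For \<open>S = 0\<close> all products \<open>cost v * m v\<close> vanish, and
    \<open>m v > 0\<close> for heavy \<open>v\<close>, so \<open>cost v = 0\<close>.\<close>
  have k_ge: "cost v \<le> S * real (k v)" if v: "v \<in> ?V - L" for v
  proof (cases "S = 0")
    case True
    then have "(\<Sum>v\<in>?V. cost v * m v) = 0" using mS by simp
    then have "cost v * m v = 0"
      using finV v cost m(1) by (subst (asm) sum_nonneg_eq_0_iff) auto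
    then show ?thesis using heavy[OF v] True by auto
  next
    case False
    have "cost v / S \<le> real (k v)" using v by (simp add: k_def real_nat_ceiling_ge)
    then show ?thesis using False S0 by (simp add: field_simps)
  qed
  have k_le: "real (k v) \<le> cost v / S + 1" if "v \<in> ?V" for v
  proof -
    have "0 \<le> cost v / S" using cost[OF that] S0 by simp
    then show ?thesis by (simp add: k_def)
  qed
  \<comment> \<open>The quotients \<open>cost v / S\<close> contribute at most
    \<open>sum m ?V\<close>, and rounding up adds at most the same amount.\<close>
  have k_m: "(\<Sum>v\<in>?V. real (k v) * m v) \<le> 2 * sum m ?V"
  proof -
    have "(\<Sum>v\<in>?V. real (k v) * m v) \<le> (\<Sum>v\<in>?V. (cost v / S + 1) * m v)"
      using k_le m by (intro sum_mono mult_right_mono) auto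
    also have "\<dots> = (\<Sum>v\<in>?V. cost v * m v) / S + sum m ?V"
      by (simp add: distrib_right sum.distrib sum_divide_distrib)
    also have "\<dots> \<le> 2 * sum m ?V" using mS msum by (cases "S = 0") auto
    finally show ?thesis .
  qed
  \<comment> \<open>A copied vertex is heavy, so counting its copies instead of weighing them costs
    a factor of at most \<open>2 * n\<close>.\<close>
  have k_sum: "(\<Sum>v\<in>?V. real (k v)) \<le> 2 * real n * (2 * sum m ?V)"
  proof -
    have "(\<Sum>v\<in>?V. real (k v)) \<le> (\<Sum>v\<in>?V. real (k v) * (2 * real n * m v))"
    proof (rule sum_mono)
      fix v assume v: "v \<in> ?V"
      show "real (k v) \<le> real (k v) * (2 * real n * m v)"
      proof (cases "v \<in> L")
        case False
        then show ?thesis using heavy v mult_left_mono[of 1 "2 * real n * m v" "real (k v)"] by auto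
      qed (simp add: k_def)
    qed
    also have "\<dots> = 2 * real n * (\<Sum>v\<in>?V. real (k v) * m v)"
      by (simp add: sum_distrib_left mult_ac)
    also have "\<dots> \<le> 2 * real n * (2 * sum m ?V)" using k_m by (intro mult_left_mono) auto
    finally show ?thesis .
  qed
  have w'_sum: "sum w' (pverts B) = (\<Sum>v\<in>?V. real (k v) * (2 * m v))"
    unfolding B_def sum_blowup[OF finV]
  proof (rule sum.cong[OF refl])
    fix v
    \<comment> \<open>The endpoint copies 0 and 1 weigh nothing, which leaves the \<open>k v\<close>
      proper copies.\<close>
    have "(\<Sum>i<k v + 2. w' (prod_encode (v, i))) = (\<Sum>i<k v. w' (prod_encode (v, i + 2)))"
      by (simp add: sum.lessThan_Suc_shift w'_def del: sum.lessThan_Suc)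
    then show "(\<Sum>i<k v + 2. w' (prod_encode (v, i))) = real (k v) * (2 * m v)"
      by (simp add: w'_def)
  qed
  have w'_le: "sum w' (pverts B) \<le> 4 * sum m ?V"
    using k_m unfolding w'_sum by (simp add: sum_distrib_left[symmetric] mult.left_commute[of _ 2])
  have cardB: "real (card (pverts B)) \<le> 6 * (real n)\<^sup>2"
  proof -
    \<comment> \<open>The term \<open>2 * n\<close> counts the two endpoint copies of each vertex;
      it is absorbed below by \<open>n \<le> n * n\<close>.\<close>
    have "real (card (pverts B)) = (\<Sum>v\<in>?V. real (k v)) + 2 * real n"
      using sum_blowup[OF finV, of "\<lambda>_. 1::real" L k] n by (simp add: B_def sum.distrib)
    also have "\<dots> \<le> 4 * (real n * real n) + 2 * real n"
      using k_sum msum(3) mult_left_mono[OF msum(3), of "real n"] by simp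
    also have "\<dots> \<le> 6 * (real n)\<^sup>2"
      by (cases n) (auto simp: power2_eq_square algebra_simps)
    finally show ?thesis .
  qed
  have w'_nonneg: "0 \<le> w' x" if "x \<in> pverts B" for x
    using that m(1) by (auto simp: B_def blowup_def w'_def)
  let ?gap = "vufg (card (pverts B)) (sum w' (pverts B))"
  have "vfg_instance (card (pverts B)) (sum w' (pverts B)) B (\<lambda>_. 1) w'"
    using w'_nonneg pair_fin_digraph_blowup[OF finV] by (auto simp: vfg_instance_def B_def)
  then have "has_cut_within_gap B (\<lambda>_. 1) w' ?gap" by (rule vufg_cut)
  then obtain X' where X': "pre_digraph.integral_vertex_cut (with_proj B) w' X'"
    and X'_card: "real (card X') \<le> sum w' (pverts B) * real ?gap"
    by (auto simp: has_cut_within_gap_def)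
  have gap: "?gap \<le> M"
  proof (rule M[OF cardB])
    show "0 \<le> sum w' (pverts B)" using w'_nonneg by (intro sum_nonneg) auto
    show "sum w' (pverts B) \<le> 6 * W" using w'_le msum by linarith
  qed
  have X'_sub: "X' \<subseteq> pverts B" using X' by (auto simp: pre_digraph.integral_vertex_cut_def)
  have finX': "finite X'"
    using X'_sub pair_fin_digraph.pair_finite_verts[OF pair_fin_digraph_blowup[OF finV]]
    unfolding B_def by (rule finite_subset)
  define X where "X = {v \<in> ?V - L. \<forall>i<k v. prod_encode (v, i + 2) \<in> X'}"
  have cut: "G.integral_vertex_cut w X"
    unfolding X_def
  proof (rule integral_vertex_cut_blowup[OF G.pair_fin_digraph_axioms])
    show "0 \<le> 2 * m v" if "v \<in> ?V" for v using m(1)[OF that] by simp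
    show "pre_digraph.integral_vertex_cut (with_proj (blowup G L k)) (blowup_weight (\<lambda>v. 2 * m v)) X'"
      using X' by (simp add: B_def w'_def)
    show "1 \<le> (\<Sum>v\<in>set xs - L. 2 * m v)"
      if "walk_via (parcs G) s xs t" "distinct xs" "1 \<le> sum w (set xs)" for s xs t
      using heavy_sum_ge[OF finV _ w that(3)] G.walk_via_in_verts(3)[OF that(1)]
      by (simp add: L_def m_def n)
  qed
  have XV: "X \<subseteq> ?V - L" and finX: "finite X" using finV by (auto simp: X_def)
  \<comment> \<open>The proper copies of the vertices of \<open>X\<close> are pairwise different and
    all lie in \<open>X'\<close>.\<close>
  have "(\<Sum>v\<in>X. k v) = card (prod_encode ` (SIGMA v:X. (\<lambda>i. i + 2) ` {..<k v}))"
    using finX by (simp add: card_image inj_on_def)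
  also have "\<dots> \<le> card X'"
    using finX' by (intro card_mono) (auto simp: X_def)
  finally have kX: "(\<Sum>v\<in>X. k v) \<le> card X'" .
  have "sum cost X \<le> (\<Sum>v\<in>X. S * real (k v))"
    using XV k_ge by (intro sum_mono) auto
  also have "\<dots> = S * real (\<Sum>v\<in>X. k v)" by (simp add: sum_distrib_left)
  also have "\<dots> \<le> S * real (card X')" using kX S0 by (intro mult_left_mono of_nat_mono)
  also have "\<dots> \<le> S * (4 * sum m ?V * real M)"
  proof (rule mult_left_mono[OF _ S0])
    have "sum w' (pverts B) * real ?gap \<le> 4 * sum m ?V * real M"
      using w'_le gap msum by (intro mult_mono) auto
    then show "real (card X') \<le> 4 * sum m ?V * real M" using X'_card by linarith
  qed
  also have "\<dots> = (\<Sum>v\<in>?V. cost v * m v) * real (4 * M)" using mS by simp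
  also have "\<dots> \<le> (\<Sum>v\<in>?V. cost v * w v) * real (4 * M)"
    using cost m by (intro mult_right_mono sum_mono mult_left_mono) auto
  finally show ?thesis using cut unfolding has_cut_within_gap_def by blast
qed

section \<open>Choice of the constant\<close>

theorem theorem7:
  "\<exists>C::real. C > 0 \<and>
     (\<forall>(n::nat) (W::real). W \<ge> 0 \<longrightarrow>
        real (vfg n W) \<le>
          C * real (Max {vufg n' W' | (n'::nat) (W'::real).
                           real n' \<le> C * (real n)\<^sup>2 \<and> 0 \<le> W' \<and> W' \<le> C * W}))"
\<comment> \<open>The constant 6 is dictated by the \<open>6 * n^2\<close> vertices of the blowup;
  for its weight and for the gap, 4 would do.\<close>
proof (intro exI[of _ 6] conjI allI impI)
  fix n :: nat and W :: real
  assume "0 \<le> W"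
  let ?A = "{vufg n' W' | (n'::nat) (W'::real). real n' \<le> 6 * (real n)\<^sup>2 \<and> 0 \<le> W' \<and> W' \<le> 6 * W}"
  \<comment> \<open>\<open>Max\<close> is only meaningful on a finite set. Although
    \<open>W'\<close> ranges over reals, the trivial bound leaves finitely many values.\<close>
  have "?A \<subseteq> {..6 * n\<^sup>2}"
  proof clarsimp
    fix n' :: nat and W' :: real
    assume "real n' \<le> 6 * (real n)\<^sup>2"
    then have "n' \<le> 6 * n\<^sup>2" by (metis of_nat_le_iff of_nat_mult of_nat_numeral of_nat_power)
    then show "vufg n' W' \<le> 6 * n\<^sup>2" using vufg_le[of n' W'] by linarith
  qed
  then have fin: "finite ?A" by (rule finite_subset) simp
  have le: "vufg n' W' \<le> Max ?A"
    if "real n' \<le> 6 * (real n)\<^sup>2" "0 \<le> W'" "W' \<le> 6 * W" for n' W'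
    using that by (intro Max_ge[OF fin]) blast
  have "vfg n W \<le> 4 * Max ?A"
    unfolding vfg_def by (rule Least_le) (use cut_from_unit_costs le in blast)
  then show "real (vfg n W) \<le> 6 * real (Max ?A)" by linarith
qed simp

end
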